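(* Let $q\ge 2$ and $d=2q-3$, and let $I$ be a parity class of $Q_d$ with complementary parity class $D$. For a colouring $c:V(Q_d)\to[q]$ put $B_i=c^{-1}(i)\cap D$ for $i\in[q]$. Then the assignment $c\mapsto(B_1,\dots,B_q)$ is a bijection from the set of extremal pair-defensive $q$-colourings of $Q_d$ with attacked parity $I$ to the set of ordered near-partitions $(B_1,\dots,B_q)$ of $D$ such that, for every $i$ with $B_i\neq\varnothing$, the induced graph $H_d[B_i]$ is triangle-free and $(q-2)$-regular. Moreover, the extension from $D$ to $I$ is unique: each vertex $x\in I$ receives the unique colour $i\in[q]$ for which $N(x)\cap B_i=\varnothing$.
   Context: The hypercube $Q_d$ is the graph on $\mathbb F_2^d$ in which two vertices are adjacent when they differ in exactly one coordinate. Its two parity classes are the vectors of even Hamming weight and those of odd Hamming weight; $I$ is one of them (the attacked parity) and $D$ the other (the defender parity). $N(x)$ is the open neighbourhood of $x$ in $Q_d$, $N[x]=N(x)\cup\{x\}$, and $[q]=\{1,\dots,q\}$. A pair-defensive $q$-colouring with attacked parity $I$ (an $(I,2,q)$-defensive silver colouring) is a surjective proper colouring $c:V(Q_d)\to[q]$, with colour classes $C_i=c^{-1}(i)$, such that for every colour $i\in[q]$ and every $S\subseteq I$ with $|S|\le 2$ there is an injective map $f:S\to C_i$ with $f(x)\in N[x]$ for all $x\in S$. Such a colouring is called extremal if it attains the bound $q=\lfloor (d+3)/2\rfloor$ on the number of colours; for $d=2q-3$ this means simply that it uses $q$ colours. The halved cube $H_d$ (on $D$) has vertex set $D$, with two vertices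 adjacent precisely when their Hamming distance is $2$; $H_d[B]$ is the subgraph induced by $B\subseteq D$. An ordered near-partition of $D$ is a labelled list $B_1,\dots,B_q$ of pairwise disjoint, possibly empty, subsets of $D$ whose union is $D$. *)

theory Defs
  imports
    "HOL-Analysis.Finite_Cartesian_Product"
    "HOL-Library.Z2"
    "HOL-Library.FuncSet"
    "HOL-Library.Disjoint_Sets"
begin

section \<open>Simple graphs\<close>

text \<open>
  Adjacency is given as a predicate; all concrete graphs below only relate members of their
  vertex set, symmetrically and irreflexively.
\<close>

record 'v graph =
  verts :: "'v set"
  adj :: "'v \<Rightarrow> 'v \<Rightarrow> bool"

definition nbhd :: "'v graph \<Rightarrow> 'v \<Rightarrow> 'v set" where
  "nbhd G x = {y \<in> verts G. adj G x y}"

definition closed_nbhd :: "'v graph \<Rightarrow> 'v \<Rightarrow> 'v set" where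
  "closed_nbhd G x = insert x (nbhd G x)"

definition induced :: "'v graph \<Rightarrow> 'v set \<Rightarrow> 'v graph" where
  "induced G B = \<lparr>verts = verts G \<inter> B, adj = (\<lambda>x y. x \<in> B \<and> y \<in> B \<and> adj G x y)\<rparr>"

definition triangle_free :: "'v graph \<Rightarrow> bool" where
  "triangle_free G \<longleftrightarrow>
    \<not> (\<exists>x\<in>verts G. \<exists>y\<in>verts G. \<exists>z\<in>verts G. adj G x y \<and> adj G y z \<and> adj G x z)"

definition regular :: "nat \<Rightarrow> 'v graph \<Rightarrow> bool" where
  "regular k G \<longleftrightarrow> (\<forall>x\<in>verts G. finite (nbhd G x) \<and> card (nbhd G x) = k)"

definition proper_colouring :: "'v graph \<Rightarrow> ('v \<Rightarrow> nat) \<Rightarrow> bool" where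
  "proper_colouring G c \<longleftrightarrow> (\<forall>x\<in>verts G. \<forall>y\<in>verts G. adj G x y \<longrightarrow> c x \<noteq> c y)"

section \<open>The hypercube and the halved cube\<close>

text \<open>
  The space of binary vectors of length \<open>d\<close> is the type \<open>bit ^ 'n\<close> with \<open>d = CARD('n)\<close>,
  where \<open>bit\<close> is the two-element field.
\<close>

definition hamming_weight :: "bit ^ 'n \<Rightarrow> nat" where
  "hamming_weight x = card {k. x $ k \<noteq> 0}"

definition hamming_dist :: "bit ^ 'n \<Rightarrow> bit ^ 'n \<Rightarrow> nat" where
  "hamming_dist x y = card {k. x $ k \<noteq> y $ k}"

definition hypercube :: "(bit ^ 'n) graph" where
  "hypercube = \<lparr>verts = UNIV, adj = (\<lambda>x y. hamming_dist x y = 1)\<rparr>"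

definition even_class :: "(bit ^ 'n) set" where
  "even_class = {x. even (hamming_weight x)}"

definition odd_class :: "(bit ^ 'n) set" where
  "odd_class = {x. odd (hamming_weight x)}"

definition halved_cube :: "(bit ^ 'n) set \<Rightarrow> (bit ^ 'n) graph" where
  "halved_cube D =
    \<lparr>verts = D, adj = (\<lambda>x y. x \<in> D \<and> y \<in> D \<and> hamming_dist x y = 2)\<rparr>"

section \<open>Pair-defensive colourings and near-partitions\<close>

definition colour_class :: "('v \<Rightarrow> nat) \<Rightarrow> nat \<Rightarrow> 'v set" where
  "colour_class c i = {x. c x = i}"

definition pair_defensive :: "(bit ^ 'n) set \<Rightarrow> nat \<Rightarrow> (bit ^ 'n \<Rightarrow> nat) \<Rightarrow> bool" where
  "pair_defensive I q c \<longleftrightarrow>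
    range c = {1..q} \<and> proper_colouring hypercube c \<and>
    (\<forall>i\<in>{1..q}. \<forall>S. S \<subseteq> I \<and> finite S \<and> card S \<le> 2 \<longrightarrow>
      (\<exists>f. f ` S \<subseteq> colour_class c i \<and> inj_on f S \<and> (\<forall>x\<in>S. f x \<in> closed_nbhd hypercube x)))"

definition extremal_pair_defensive ::
    "(bit ^ 'n) set \<Rightarrow> nat \<Rightarrow> (bit ^ 'n \<Rightarrow> nat) \<Rightarrow> bool" where
  "extremal_pair_defensive I q c \<longleftrightarrow> pair_defensive I q c \<and> q = (CARD('n) + 3) div 2"

text \<open>
  The labelled list \<open>B\<^sub>1, \<dots>, B\<^sub>q\<close> is a function on \<open>{1..q}\<close>; extensionality fixes its
  irrelevant values outside \<open>{1..q}\<close>, so that equality of such functions is equality of lists.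
\<close>

definition near_partitions :: "nat \<Rightarrow> 'v set \<Rightarrow> (nat \<Rightarrow> 'v set) set" where
  "near_partitions q D =
    {B \<in> extensional {1..q}. disjoint_family_on B {1..q} \<and> (\<Union>i\<in>{1..q}. B i) = D}"

definition defender_parts :: "nat \<Rightarrow> 'v set \<Rightarrow> ('v \<Rightarrow> nat) \<Rightarrow> nat \<Rightarrow> 'v set" where
  "defender_parts q D c = (\<lambda>i\<in>{1..q}. colour_class c i \<inter> D)"

end

theory Submission
  imports Defs
begin

text \<open>
  For a vertex \<open>x\<close> let \<open>m\<^sub>i(x)\<close> be the number of its neighbours with colour \<open>i\<close>, written
  \<open>mult c x i\<close> below.  When \<open>x \<in> I\<close>, these neighbours lie in \<open>D\<close>, so \<open>m\<^sub>i(x)\<close> depends only on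
  the parts \<open>B\<^sub>i\<close>, and \<open>\<Sum>\<^sub>i m\<^sub>i(x) = 2q - 3\<close>.  Both sides of the bijection are equivalent to one
  local condition on the colouring of \<open>D\<close>, called \<open>balanced\<close>: all \<open>m\<^sub>i(x)\<close> are at most two, and
  every \<open>v \<in> D\<close> of colour \<open>i\<close> has exactly one neighbour \<open>x\<close> with \<open>m\<^sub>i(x) = 1\<close>, that is, one
  neighbour that only \<open>v\<close> can defend in colour \<open>i\<close>.

  Parts.  Distinct vertices of \<open>D\<close> have a common neighbour exactly when they are at distance two, and
  then they have two.  Three vertices pairwise at distance two have a common neighbour.  Hence
  \<open>H\<^sub>d[B\<^sub>i]\<close> is triangle-free iff \<open>m\<^sub>i \<le> 2\<close> on \<open>I\<close>.  Moreover, summing \<open>m\<^sub>i(x) - 1\<close> over the \<open>d\<close>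
  neighbours \<open>x\<close> of \<open>v \<in> B\<^sub>i\<close> gives twice the degree of \<open>v\<close> in \<open>H\<^sub>d[B\<^sub>i]\<close>.  If \<open>m\<^sub>i \<le> 2\<close>, the degree is
  therefore \<open>q - 2 = (d - 1) / 2\<close> iff exactly one of the summands vanishes
  (\<open>good_parts_iff_balanced\<close>).

  Defence.  In an extremal colouring the colour of \<open>x \<in> I\<close> is missing from its neighbourhood, while
  single-vertex defence makes the other \<open>q - 1\<close> colours occur there.  Since these multiplicities add
  up to \<open>2(q - 1) - 1\<close>, at least one of them is one.  Pair defence says that no \<open>v \<in> D\<close> is the only
  defender in its colour of two neighbours.  So the pairs \<open>(x, i)\<close> with \<open>m\<^sub>i(x) = 1\<close>, each of which
  singles out one \<open>v\<close>, number at least \<open>|I|\<close> and at most \<open>|D|\<close>.  As \<open>|I| = |D|\<close>, equality holds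
  everywhere, and the other \<open>q - 2\<close> multiplicities at \<open>x\<close> must all be two
  (\<open>extremal_imp_balanced\<close>).

  Extension.  In a balanced colouring with \<open>z\<close> zeros and \<open>a\<close> ones among the multiplicities at \<open>x\<close>,
  the total \<open>2q - 3\<close> forces \<open>2z + a = 3\<close>, so \<open>a \<ge> 1\<close>; the same double count forces \<open>a = 1\<close>, hence
  \<open>z = 1\<close> (\<open>balanced_missing_colour\<close>).  Giving each \<open>x \<in> I\<close> its single missing colour is thus the
  only candidate for an extension, and it is pair-defensive (\<open>balanced_imp_extremal\<close>).
\<close>

section \<open>Local structure of the hypercube\<close>

instance bit :: finite
proof
  have "(UNIV :: bit set) = {0, 1}"
    by (auto intro: bit_not_zero_iff[THEN iffD1])
  then show "finite (UNIV :: bit set)"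
    by (metis finite.emptyI finite.insertI)
qed

definition flip :: "'n \<Rightarrow> bit ^ 'n \<Rightarrow> bit ^ 'n::finite" where
  "flip k x = (\<chi> i. if i = k then x $ i + 1 else x $ i)"

lemma flip_nth_eq_1: "flip k x $ i = 1 \<longleftrightarrow> (x $ i = 1) \<noteq> (i = k)"
  by (cases "x $ i = 1") (auto simp: flip_def)

text \<open>
  Equality of entries is reduced to the truth values \<open>x $ i = 1\<close>, so that identities between
  flipped vectors become propositional.
\<close>

lemma bit_nth_eq_iff: "x $ i = y $ j \<longleftrightarrow> (x $ i = 1 \<longleftrightarrow> y $ j = 1)" for x y :: "bit ^ 'n::finite"
  by (metis bit_not_one_iff)

lemma bit_vec_eq_iff: "x = y \<longleftrightarrow> (\<forall>i. x $ i = 1 \<longleftrightarrow> y $ i = 1)" for x y :: "bit ^ 'n::finite"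
  unfolding vec_eq_iff by (metis bit_nth_eq_iff)

lemma flip_flip [simp]: "flip k (flip k x) = x"
  by (auto simp: bit_vec_eq_iff flip_nth_eq_1)

lemma flip_commute: "flip j (flip k x) = flip k (flip j x)"
  by (auto simp: bit_vec_eq_iff flip_nth_eq_1)

lemma flip_eq_iff [simp]: "flip j x = flip k x \<longleftrightarrow> j = k"
  by (auto simp: bit_vec_eq_iff flip_nth_eq_1)

lemma hamming_dist_commute: "hamming_dist x y = hamming_dist y x"
  unfolding hamming_dist_def by (rule arg_cong[where f = card]) auto

lemma hamming_dist_eq_1_iff: "hamming_dist x y = 1 \<longleftrightarrow> (\<exists>k. y = flip k x)"
proof -
  have "{i. x $ i \<noteq> y $ i} = {k} \<longleftrightarrow> y = flip k x" for k
  proof -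
    have "(x $ i \<noteq> y $ i \<longleftrightarrow> i = k) \<longleftrightarrow> (y $ i = 1 \<longleftrightarrow> flip k x $ i = 1)" for i
      unfolding bit_nth_eq_iff[of x i y i] flip_nth_eq_1 by argo
    then show ?thesis
      by (simp add: set_eq_iff bit_vec_eq_iff)
  qed
  then show ?thesis
    by (simp add: hamming_dist_def card_1_singleton_iff)
qed

lemma hamming_dist_eq_2_iff:
  "hamming_dist x y = 2 \<longleftrightarrow> (\<exists>j k. j \<noteq> k \<and> y = flip j (flip k x))"
proof
  assume "hamming_dist x y = 2"
  then obtain j k where "j \<noteq> k" and jk: "{i. x $ i \<noteq> y $ i} = {j, k}"
    unfolding hamming_dist_def card_2_iff by auto
  have "y $ i = 1 \<longleftrightarrow> (x $ i = 1) \<noteq> (i \<in> {j, k})" for i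
  proof -
    have "i \<in> {j, k} \<longleftrightarrow> x $ i \<noteq> y $ i"
      using jk by blast
    then show ?thesis
      unfolding bit_nth_eq_iff by argo
  qed
  with \<open>j \<noteq> k\<close> have "y = flip j (flip k x)"
    by (auto simp: bit_vec_eq_iff flip_nth_eq_1)
  with \<open>j \<noteq> k\<close> show "\<exists>j k. j \<noteq> k \<and> y = flip j (flip k x)" by blast
next
  assume "\<exists>j k. j \<noteq> k \<and> y = flip j (flip k x)"
  then obtain j k where "j \<noteq> k" "y = flip j (flip k x)" by blast
  then have "{i. x $ i \<noteq> y $ i} = {j, k}"
    by (auto simp: bit_nth_eq_iff flip_nth_eq_1)
  with \<open>j \<noteq> k\<close> show "hamming_dist x y = 2"
    by (simp add: hamming_dist_def)
qed

lemma mem_nbhd_iff: "y \<in> nbhd hypercube x \<longleftrightarrow> (\<exists>k. y = flip k x)"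
  unfolding nbhd_def hypercube_def by (simp add: hamming_dist_eq_1_iff del: One_nat_def)

lemma nbhd_sym: "y \<in> nbhd hypercube x \<longleftrightarrow> x \<in> nbhd hypercube y"
  by (simp add: nbhd_def hypercube_def hamming_dist_commute)

lemma card_nbhd: "card (nbhd hypercube (x :: bit ^ 'n::finite)) = CARD('n)"
proof -
  have "nbhd hypercube x = range (\<lambda>k. flip k x)"
    by (auto simp: mem_nbhd_iff)
  moreover have "inj (\<lambda>k. flip k x)"
    by (simp add: inj_on_def)
  ultimately show ?thesis by (simp add: card_image)
qed

text \<open>
  Two coordinate flips lead from \<open>x\<close> to a vertex at distance two, and the common neighbours
  are the two halfway points, one for each order of the flips.
\<close>

lemma card_common_nbhd:
  assumes "x \<noteq> y"
  shows "card (nbhd hypercube x \<inter> nbhd hypercube y) = (if hamming_dist x y = 2 then 2 else 0)"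
proof (cases "hamming_dist x y = 2")
  case True
  then obtain j k where jk: "j \<noteq> k" "y = flip j (flip k x)"
    unfolding hamming_dist_eq_2_iff by blast
  have "nbhd hypercube x \<inter> nbhd hypercube y = {flip j x, flip k x}"
  proof
    show "nbhd hypercube x \<inter> nbhd hypercube y \<subseteq> {flip j x, flip k x}"
    proof
      fix w assume "w \<in> nbhd hypercube x \<inter> nbhd hypercube y"
      then obtain a b where w: "w = flip a x" "w = flip b y"
        unfolding Int_iff mem_nbhd_iff by blast
      then have "flip a x = flip b (flip j (flip k x))"
        using jk by simp
      then have "(i = a) = ((i = b) = ((i = j) = (i = k)))" for i
        unfolding bit_vec_eq_iff flip_nth_eq_1 by metis
      then have "a = j \<or> a = k"
        using jk(1) by metis
      with w show "w \<in> {flip j x, flip k x}" by auto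
    qed
    have "flip j x = flip k y" "flip k x = flip j y"
      using jk(2) by (simp_all add: flip_commute[of j k])
    then have "flip j x \<in> nbhd hypercube x \<inter> nbhd hypercube y"
        "flip k x \<in> nbhd hypercube x \<inter> nbhd hypercube y"
      by (metis IntI mem_nbhd_iff)+
    then show "{flip j x, flip k x} \<subseteq> nbhd hypercube x \<inter> nbhd hypercube y"
      by blast
  qed
  with True jk(1) show ?thesis by simp
next
  case False
  have "nbhd hypercube x \<inter> nbhd hypercube y = {}"
  proof (rule ccontr)
    assume "nbhd hypercube x \<inter> nbhd hypercube y \<noteq> {}"
    then obtain a b where "flip a x = flip b y"
      by (auto simp: mem_nbhd_iff)
    then have "y = flip b (flip a x)" by simp
    moreover from this \<open>x \<noteq> y\<close> have "b \<noteq> a" by auto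
    ultimately show False
      using False by (auto simp: hamming_dist_eq_2_iff)
  qed
  with False show ?thesis by simp
qed

text \<open>
  If \<open>y\<close> and \<open>z\<close> arise from \<open>x\<close> by flipping disjoint pairs of coordinates, they are at
  distance four.  So the two pairs share a coordinate, and flipping it gives the common neighbour.
\<close>

lemma triangle_has_common_neighbour:
  assumes "hamming_dist x y = 2" "hamming_dist x z = 2" "hamming_dist y z = 2"
  obtains w where "x \<in> nbhd hypercube w" "y \<in> nbhd hypercube w" "z \<in> nbhd hypercube w"
proof -
  obtain a b where ab: "a \<noteq> b" "y = flip a (flip b x)"
    using assms(1) by (auto simp: hamming_dist_eq_2_iff)
  obtain c d where cd: "c \<noteq> d" "z = flip c (flip d x)"
    using assms(2) by (auto simp: hamming_dist_eq_2_iff)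
  have "{a, b} \<inter> {c, d} \<noteq> {}"
  proof
    assume "{a, b} \<inter> {c, d} = {}"
    then have "{i. y $ i \<noteq> z $ i} = {a, b, c, d}"
      using ab cd by (auto simp: bit_nth_eq_iff flip_nth_eq_1)
    with \<open>{a, b} \<inter> {c, d} = {}\<close> ab(1) cd(1) have "hamming_dist y z = 4"
      by (auto simp: hamming_dist_def)
    with assms(3) show False by simp
  qed
  then obtain e f g where e: "y = flip f (flip e x)" "z = flip g (flip e x)"
    using ab(2) cd(2) flip_commute by blast
  show thesis
  proof
    show "x \<in> nbhd hypercube (flip e x)" by (metis mem_nbhd_iff flip_flip)
    show "y \<in> nbhd hypercube (flip e x)" "z \<in> nbhd hypercube (flip e x)"
      using e by (auto simp: mem_nbhd_iff)
  qed
qed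

text \<open>A flip adds or removes exactly one nonzero coordinate.\<close>

lemma even_hamming_weight_flip:
  "even (hamming_weight (flip k x)) \<longleftrightarrow> odd (hamming_weight x)"
proof (cases "x $ k = 1")
  case True
  then have "{i. x $ i = 1} = insert k {i. flip k x $ i = 1}" "k \<notin> {i. flip k x $ i = 1}"
    by (auto simp: flip_nth_eq_1)
  then show ?thesis by (simp add: hamming_weight_def)
next
  case False
  then have "{i. flip k x $ i = 1} = insert k {i. x $ i = 1}" "k \<notin> {i. x $ i = 1}"
    by (auto simp: flip_nth_eq_1)
  then show ?thesis by (simp add: hamming_weight_def)
qed

lemma halved_induced_simps:
  "verts (induced (halved_cube D) B) = D \<inter> B"
  "adj (induced (halved_cube D) B) v w \<longleftrightarrow>
     v \<in> D \<inter> B \<and> w \<in> D \<inter> B \<and> hamming_dist v w = 2"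
  by (auto simp: induced_def halved_cube_def)

section \<open>Colour multiplicities around a vertex\<close>

definition mult :: "(bit ^ 'n::finite \<Rightarrow> nat) \<Rightarrow> bit ^ 'n \<Rightarrow> nat \<Rightarrow> nat" where
  "mult c x i = card {v \<in> nbhd hypercube x. c v = i}"

lemma mult_eq_0_iff: "mult c x i = 0 \<longleftrightarrow> (\<forall>v\<in>nbhd hypercube x. c v \<noteq> i)"
  by (auto simp: mult_def)

lemma mult_pos: "v \<in> nbhd hypercube x \<Longrightarrow> 0 < mult c x (c v)"
  using mult_eq_0_iff[of c x "c v"] by auto

lemma mult_eq_1_unique:
  assumes "mult c x i = 1" "v \<in> nbhd hypercube x" "w \<in> nbhd hypercube x" "c v = i" "c w = i"
  shows "v = w"
proof -
  obtain u where "{v \<in> nbhd hypercube x. c v = i} = {u}"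
    using assms(1) unfolding mult_def card_1_singleton_iff One_nat_def by blast
  with assms(2-) show ?thesis
    by (metis (mono_tags, lifting) mem_Collect_eq singletonD)
qed

lemma mult_cong: "(\<And>v. v \<in> nbhd hypercube x \<Longrightarrow> c v = c' v) \<Longrightarrow> mult c x i = mult c' x i"
  unfolding mult_def by (rule arg_cong[where f = card]) auto

lemma sum_mult:
  fixes x :: "bit ^ 'n::finite"
  assumes "finite K" "c ` nbhd hypercube x \<subseteq> K"
  shows "(\<Sum>i\<in>K. mult c x i) = CARD('n)"
  using sum.group[of "nbhd hypercube x" K c "\<lambda>_. 1 :: nat"] assms
  by (simp add: mult_def card_nbhd)

text \<open>
  Sum the pointwise identity \<open>m + 2 [m = 0] + [m = 1] = 2 + (m - 2)\<close> with truncated subtraction.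
  Everything that a total of \<open>2 |K| - 3\<close> says about the numbers of zeros and ones can be read
  off from it.
\<close>

lemma zeros_ones_identity:
  fixes m :: "nat \<Rightarrow> nat"
  assumes "finite K" "2 \<le> card K" "(\<Sum>i\<in>K. m i) = 2 * card K - 3"
  shows "2 * card {i \<in> K. m i = 0} + card {i \<in> K. m i = 1} = 3 + (\<Sum>i\<in>K. m i - 2)"
proof -
  have "(\<Sum>i\<in>K. m i + 2 * of_bool (m i = 0) + of_bool (m i = 1)) = (\<Sum>i\<in>K. 2 + (m i - 2))"
    by (rule sum.cong) auto
  then have "(\<Sum>i\<in>K. m i) + 2 * card {i \<in> K. m i = 0} + card {i \<in> K. m i = 1}
      = 2 * card K + (\<Sum>i\<in>K. m i - 2)"
    using assms(1) by (simp add: sum.distrib sum_distrib_left[symmetric] sum_of_bool_eq Int_def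
        del: add_2_eq_Suc add_2_eq_Suc')
  with assms show ?thesis by simp
qed

text \<open>
  Count the pairs \<open>(x, w)\<close> in which \<open>w \<noteq> v\<close> has the colour of \<open>v\<close> and \<open>x\<close> is a common neighbour of
  \<open>v\<close> and \<open>w\<close>.  Each \<open>x\<close> sees all vertices of that colour around it except \<open>v\<close>; each \<open>w\<close> at distance
  two is seen twice, any other \<open>w\<close> never.
\<close>

lemma sum_mult_minus_1:
  "(\<Sum>x\<in>nbhd hypercube v. mult c x (c v) - 1) = 2 * card {w. c w = c v \<and> hamming_dist v w = 2}"
proof -
  define W where "W = {w. c w = c v \<and> w \<noteq> v}"
  have "mult c x (c v) - 1 = card {w \<in> W. w \<in> nbhd hypercube x}" if "x \<in> nbhd hypercube v" for x
  proof -
    have "{u \<in> nbhd hypercube x. c u = c v} = insert v {w \<in> W. w \<in> nbhd hypercube x}"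
      using that by (auto simp: W_def nbhd_sym[of v x])
    moreover have "v \<notin> W" by (simp add: W_def)
    ultimately show ?thesis by (simp add: mult_def)
  qed
  then have "(\<Sum>x\<in>nbhd hypercube v. mult c x (c v) - 1)
      = (\<Sum>x\<in>nbhd hypercube v. card {w \<in> W. w \<in> nbhd hypercube x})"
    by simp
  also have "\<dots> = (\<Sum>w\<in>W. card {x \<in> nbhd hypercube v. w \<in> nbhd hypercube x})"
    by (rule sum_multicount_gen) auto
  also have "\<dots> = (\<Sum>w\<in>W. 2 * of_bool (hamming_dist v w = 2))"
  proof (rule sum.cong[OF refl])
    fix w assume "w \<in> W"
    have "{x \<in> nbhd hypercube v. w \<in> nbhd hypercube x} = nbhd hypercube v \<inter> nbhd hypercube w"
      by (auto simp: nbhd_sym[of w])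
    moreover have "v \<noteq> w"
      using \<open>w \<in> W\<close> by (auto simp: W_def)
    ultimately show "card {x \<in> nbhd hypercube v. w \<in> nbhd hypercube x}
        = 2 * of_bool (hamming_dist v w = 2)"
      by (simp add: card_common_nbhd)
  qed
  also have "\<dots> = 2 * card {w \<in> W. hamming_dist v w = 2}"
    by (simp add: sum_distrib_left[symmetric] sum_of_bool_eq Int_def)
  also have "{w \<in> W. hamming_dist v w = 2} = {w. c w = c v \<and> hamming_dist v w = 2}"
    by (auto simp: W_def hamming_dist_def)
  finally show ?thesis .
qed

text \<open>
  If all multiplicities are one or two, a neighbour \<open>x\<close> of \<open>v\<close> that is not counted in the first term
  contributes exactly one to the preceding sum.
\<close>

lemma degree_identity:
  fixes v :: "bit ^ 'n::finite"
  assumes "\<And>x. x \<in> nbhd hypercube v \<Longrightarrow> mult c x (c v) \<le> 2"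
  shows "card {x \<in> nbhd hypercube v. mult c x (c v) = 1}
    + 2 * card {w. c w = c v \<and> hamming_dist v w = 2} = CARD('n)"
proof -
  have "of_bool (mult c x (c v) = 1) + (mult c x (c v) - 1) = (1 :: nat)"
    if "x \<in> nbhd hypercube v" for x
    using assms[OF that] mult_pos[of v x c] that by (auto simp: nbhd_sym[of v x])
  then have "(\<Sum>x\<in>nbhd hypercube v. of_bool (mult c x (c v) = 1) + (mult c x (c v) - 1))
      = card (nbhd hypercube v)"
    by simp
  then show ?thesis
    by (simp add: sum.distrib sum_mult_minus_1 card_nbhd sum_of_bool_eq Int_def
        del: One_nat_def)
qed

section \<open>Balanced colourings\<close>

locale parity_classes =
  fixes q :: nat and I D :: "(bit ^ 'n::finite) set"
  assumes q_ge_2: "q \<ge> 2"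
    and card_coords: "CARD('n) = 2 * q - 3"
    and parity: "(I = even_class \<and> D = odd_class) \<or> (I = odd_class \<and> D = even_class)"
begin

lemma mem_I_iff: "x \<in> I \<longleftrightarrow> x \<notin> D"
  using parity by (auto simp: even_class_def odd_class_def)

lemma flip_mem_D_iff: "flip k x \<in> D \<longleftrightarrow> x \<in> I"
  using parity by (auto simp: even_class_def odd_class_def even_hamming_weight_flip)

lemma nbhd_mem_D: "x \<in> I \<Longrightarrow> v \<in> nbhd hypercube x \<Longrightarrow> v \<in> D"
  by (auto simp: mem_nbhd_iff flip_mem_D_iff)

lemma nbhd_mem_I: "v \<in> D \<Longrightarrow> x \<in> nbhd hypercube v \<Longrightarrow> x \<in> I"
  using mem_I_iff flip_mem_D_iff by (auto simp: mem_nbhd_iff)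

lemma mem_D_if_dist_2: "v \<in> D \<Longrightarrow> hamming_dist v w = 2 \<Longrightarrow> w \<in> D"
  using mem_I_iff flip_mem_D_iff by (auto simp: hamming_dist_eq_2_iff)

lemma card_I_eq_card_D: "card I = card D"
proof (rule bij_betw_same_card)
  fix k :: 'n
  show "bij_betw (flip k) I D"
    by (rule bij_betw_byWitness[where f' = "flip k"]) (use mem_I_iff flip_mem_D_iff in auto)
qed

lemma I_nonempty: "I \<noteq> {}"
proof -
  fix k :: 'n
  have "0 \<in> I \<or> flip k 0 \<in> I"
    using mem_I_iff flip_mem_D_iff by blast
  then show ?thesis by blast
qed

lemma zeros_ones_identity_mult:
  assumes "x \<in> I" "c ` D \<subseteq> {1..q}"
  shows "2 * card {i \<in> {1..q}. mult c x i = 0} + card {i \<in> {1..q}. mult c x i = 1}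
    = 3 + (\<Sum>i\<in>{1..q}. mult c x i - 2)"
proof (rule zeros_ones_identity)
  have "c ` nbhd hypercube x \<subseteq> {1..q}"
    using assms nbhd_mem_D by blast
  then show "(\<Sum>i\<in>{1..q}. mult c x i) = 2 * card {1..q} - 3"
    by (simp add: sum_mult card_coords)
qed (use q_ge_2 in auto)

text \<open>
  A colour of multiplicity one at \<open>x\<close> is the same thing as a neighbour of \<open>x\<close> that is alone in its
  colour there.  Both sides therefore count the edges between such a neighbour and \<open>x\<close>.
\<close>

lemma double_count_ones:
  assumes "c ` D \<subseteq> {1..q}"
  shows "(\<Sum>x\<in>I. card {i \<in> {1..q}. mult c x i = 1})
    = (\<Sum>v\<in>D. card {x \<in> nbhd hypercube v. mult c x (c v) = 1})"
proof -
  let ?R = "\<lambda>x v. v \<in> nbhd hypercube x \<and> mult c x (c v) = 1"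
  have "card {i \<in> {1..q}. mult c x i = 1} = card {v \<in> D. ?R x v}" if "x \<in> I" for x
  proof (rule bij_betw_same_card[symmetric])
    have "inj_on c {v \<in> D. ?R x v}"
    proof (rule inj_onI)
      fix v w assume "v \<in> {v \<in> D. ?R x v}" "w \<in> {v \<in> D. ?R x v}" "c v = c w"
      then show "v = w"
        by (intro mult_eq_1_unique[of c x "c v" v w]) auto
    qed
    moreover have "c ` {v \<in> D. ?R x v} = {i \<in> {1..q}. mult c x i = 1}"
    proof
      show "c ` {v \<in> D. ?R x v} \<subseteq> {i \<in> {1..q}. mult c x i = 1}"
        using assms by auto
      show "{i \<in> {1..q}. mult c x i = 1} \<subseteq> c ` {v \<in> D. ?R x v}"
      proof
        fix i assume i: "i \<in> {i \<in> {1..q}. mult c x i = 1}"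
        then have "mult c x i \<noteq> 0" by simp
        then obtain v where "v \<in> nbhd hypercube x" "c v = i"
          unfolding mult_eq_0_iff by blast
        with i that show "i \<in> c ` {v \<in> D. ?R x v}"
          using nbhd_mem_D by auto
      qed
    qed
    ultimately show "bij_betw c {v \<in> D. ?R x v} {i \<in> {1..q}. mult c x i = 1}"
      by (simp add: bij_betw_def)
  qed
  then have "(\<Sum>x\<in>I. card {i \<in> {1..q}. mult c x i = 1}) = (\<Sum>x\<in>I. card {v \<in> D. ?R x v})"
    by simp
  also have "\<dots> = (\<Sum>v\<in>D. card {x \<in> I. ?R x v})"
    by (rule sum_multicount_gen) auto
  also have "\<dots> = (\<Sum>v\<in>D. card {x \<in> nbhd hypercube v. mult c x (c v) = 1})"
  proof (rule sum.cong[OF refl])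
    fix v assume "v \<in> D"
    then have "{x \<in> I. ?R x v} = {x \<in> nbhd hypercube v. mult c x (c v) = 1}"
      using nbhd_mem_I nbhd_sym by blast
    then show "card {x \<in> I. ?R x v} = card {x \<in> nbhd hypercube v. mult c x (c v) = 1}"
      by simp
  qed
  finally show ?thesis .
qed

text \<open>
  The double count squeezes the number of these edges between \<open>|I|\<close> and \<open>|D|\<close>, which are equal, so
  neither bound can be strict at any vertex.
\<close>

lemma one_colour_of_mult_1:
  assumes "c ` D \<subseteq> {1..q}"
    and "\<And>x. x \<in> I \<Longrightarrow> 1 \<le> card {i \<in> {1..q}. mult c x i = 1}"
    and "\<And>v. v \<in> D \<Longrightarrow> card {x \<in> nbhd hypercube v. mult c x (c v) = 1} \<le> 1"
  shows "x \<in> I \<Longrightarrow> card {i \<in> {1..q}. mult c x i = 1} = 1"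
    and "v \<in> D \<Longrightarrow> card {x \<in> nbhd hypercube v. mult c x (c v) = 1} = 1"
proof -
  let ?a = "\<lambda>x. card {i \<in> {1..q}. mult c x i = 1}"
  let ?s = "\<lambda>v. card {x \<in> nbhd hypercube v. mult c x (c v) = 1}"
  have upper: "sum ?s D \<le> card D"
    using sum_mono[of D ?s "\<lambda>_. 1"] assms(3) by simp
  have lower: "card I \<le> sum ?a I"
    using sum_mono[of I "\<lambda>_. 1" ?a] assms(2) by simp
  note eq = double_count_ones[OF assms(1)]
  show "?a x = 1" if "x \<in> I"
  proof (rule ccontr)
    assume "?a x \<noteq> 1"
    then have "1 < ?a x" using assms(2)[OF that] by linarith
    then have "(\<Sum>x\<in>I. 1) < sum ?a I"
      using that assms(2) by (intro sum_strict_mono_ex1) auto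
    with upper eq show False by (simp add: card_I_eq_card_D)
  qed
  show "?s v = 1" if "v \<in> D"
  proof (rule ccontr)
    assume "?s v \<noteq> 1"
    then have "?s v < 1" using assms(3)[OF that] by linarith
    then have "sum ?s D < (\<Sum>v\<in>D. 1)"
      using that assms(3) by (intro sum_strict_mono_ex1) auto
    with lower eq show False by (simp add: card_I_eq_card_D)
  qed
qed

text \<open>
  Only the values of \<open>c\<close> on \<open>D\<close> enter: the neighbours of a vertex of \<open>I\<close> lie in \<open>D\<close>.  So the condition
  makes sense for colourings of \<open>D\<close> that have yet to be extended.
\<close>

definition balanced :: "(bit ^ 'n \<Rightarrow> nat) \<Rightarrow> bool" where
  "balanced c \<longleftrightarrow>
    c ` D \<subseteq> {1..q} \<and>
    (\<forall>x\<in>I. \<forall>i\<in>{1..q}. mult c x i \<le> 2) \<and>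
    (\<forall>v\<in>D. card {x \<in> nbhd hypercube v. mult c x (c v) = 1} = 1)"

lemma balanced_cong:
  assumes "\<And>v. v \<in> D \<Longrightarrow> c v = c' v" "balanced c"
  shows "balanced c'"
proof -
  have mult: "mult c' x i = mult c x i" if "x \<in> I" for x i
    using assms(1)[OF nbhd_mem_D[OF that]] by (intro mult_cong) simp
  moreover have "{x \<in> nbhd hypercube v. mult c' x (c' v) = 1}
      = {x \<in> nbhd hypercube v. mult c x (c v) = 1}" if "v \<in> D" for v
    using mult[OF nbhd_mem_I[OF that]] assms(1)[OF that] by (intro Collect_cong) auto
  ultimately show ?thesis
    using assms unfolding balanced_def by (auto simp: image_subset_iff)
qed

text \<open>
  With multiplicities at most two, the identity for zeros and ones reads \<open>2 z + a = 3\<close>.  Then \<open>a\<close> is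
  odd, hence at least one, and the squeeze makes it one.
\<close>

lemma balanced_missing_colour:
  assumes "balanced c" "x \<in> I"
  shows "\<exists>!i. i \<in> {1..q} \<and> mult c x i = 0"
proof -
  let ?z = "\<lambda>x. card {i \<in> {1..q}. mult c x i = 0}"
  let ?a = "\<lambda>x. card {i \<in> {1..q}. mult c x i = 1}"
  have D: "c ` D \<subseteq> {1..q}" using assms(1) by (simp add: balanced_def)
  have id: "2 * ?z x + ?a x = 3" if "x \<in> I" for x
    using zeros_ones_identity_mult[OF that D] assms(1) that by (simp add: balanced_def)
  have "1 \<le> ?a x" if "x \<in> I" for x
    using id[OF that] by presburger
  then have "?a x = 1"
    using one_colour_of_mult_1(1)[OF D] assms by (simp add: balanced_def)
  with id[OF assms(2)] have "?z x = 1" by simp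
  then obtain u where u: "{i \<in> {1..q}. mult c x i = 0} = {u}"
    by (rule card_1_singletonE)
  have missing: "i \<in> {1..q} \<and> mult c x i = 0 \<longleftrightarrow> i = u" for i
    using u unfolding set_eq_iff mem_Collect_eq singleton_iff by (rule spec)
  show ?thesis unfolding missing by simp
qed

section \<open>Balanced colourings are the colourings with good parts\<close>

text \<open>
  Three vertices of one colour around \<open>x\<close> are pairwise at distance two, because they share the
  neighbour \<open>x\<close>; conversely every triangle of the halved cube lies around some vertex.
\<close>

lemma triangle_free_colour_class_iff:
  "triangle_free (induced (halved_cube D) (colour_class c i \<inter> D)) \<longleftrightarrow> (\<forall>x\<in>I. mult c x i \<le> 2)"
proof
  assume tf: "triangle_free (induced (halved_cube D) (colour_class c i \<inter> D))"
  show "\<forall>x\<in>I. mult c x i \<le> 2"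
  proof (intro ballI, rule ccontr)
    fix x assume "x \<in> I" "\<not> mult c x i \<le> 2"
    then have "3 \<le> card {v \<in> nbhd hypercube x. c v = i}"
      by (simp add: mult_def)
    then obtain T where T: "T \<subseteq> {v \<in> nbhd hypercube x. c v = i}" "card T = 3"
      by (elim obtain_subset_with_card_n) blast
    have dist: "hamming_dist u v = 2" if "u \<in> T" "v \<in> T" "u \<noteq> v" for u v
    proof -
      have "x \<in> nbhd hypercube u \<inter> nbhd hypercube v"
        using that T(1) nbhd_sym by blast
      then show ?thesis
        using card_common_nbhd[OF \<open>u \<noteq> v\<close>] by (auto split: if_splits)
    qed
    from T(2) obtain u v w where uvw: "T = {u, v, w}" "u \<noteq> v" "v \<noteq> w" "u \<noteq> w"
      unfolding card_3_iff by auto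
    have "z \<in> D \<inter> (colour_class c i \<inter> D)" if "z \<in> T" for z
      using that T(1) nbhd_mem_D[OF \<open>x \<in> I\<close>] by (auto simp: colour_class_def)
    then have mem: "u \<in> D \<inter> (colour_class c i \<inter> D)" "v \<in> D \<inter> (colour_class c i \<inter> D)"
        "w \<in> D \<inter> (colour_class c i \<inter> D)"
      using uvw(1) by simp_all
    moreover have "hamming_dist u v = 2" "hamming_dist v w = 2" "hamming_dist u w = 2"
      using dist uvw by simp_all
    ultimately show False
      using tf unfolding triangle_free_def halved_induced_simps by metis
  qed
next
  assume le: "\<forall>x\<in>I. mult c x i \<le> 2"
  show "triangle_free (induced (halved_cube D) (colour_class c i \<inter> D))"
    unfolding triangle_free_def halved_induced_simps
  proof (intro notI, elim bexE conjE)
    fix u v w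
    assume mem: "u \<in> D \<inter> (colour_class c i \<inter> D)" "v \<in> D \<inter> (colour_class c i \<inter> D)"
        "w \<in> D \<inter> (colour_class c i \<inter> D)"
      and dist: "hamming_dist u v = 2" "hamming_dist v w = 2" "hamming_dist u w = 2"
    obtain x where x: "u \<in> nbhd hypercube x" "v \<in> nbhd hypercube x" "w \<in> nbhd hypercube x"
      using triangle_has_common_neighbour[OF dist(1,3,2)] by blast
    have "{u, v, w} \<subseteq> {v \<in> nbhd hypercube x. c v = i}"
      using x mem by (auto simp: colour_class_def)
    then have "card {u, v, w} \<le> mult c x i"
      unfolding mult_def by (intro card_mono) auto
    moreover have "u \<noteq> v" "v \<noteq> w" "u \<noteq> w"
      using dist by (auto simp: hamming_dist_def)
    moreover have "x \<in> I"
      using x(1) mem(1) nbhd_mem_I nbhd_sym by blast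
    ultimately show False using le by fastforce
  qed
qed

lemma regular_colour_class_iff:
  "regular k (induced (halved_cube D) (colour_class c i \<inter> D)) \<longleftrightarrow>
    (\<forall>v\<in>D. c v = i \<longrightarrow> card {w. c w = c v \<and> hamming_dist v w = 2} = k)"
proof -
  have "nbhd (induced (halved_cube D) (colour_class c i \<inter> D)) v
      = {w. c w = c v \<and> hamming_dist v w = 2}" if "v \<in> D" "c v = i" for v
    using that mem_D_if_dist_2 by (auto simp: nbhd_def halved_induced_simps colour_class_def)
  then show ?thesis
    by (auto simp: regular_def halved_induced_simps colour_class_def)
qed

lemma good_parts_iff_balanced:
  assumes "c ` D \<subseteq> {1..q}"
  shows "(\<forall>i\<in>{1..q}. defender_parts q D c i \<noteq> {} \<longrightarrow>
      triangle_free (induced (halved_cube D) (defender_parts q D c i)) \<and>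
      regular (q - 2) (induced (halved_cube D) (defender_parts q D c i)))
    \<longleftrightarrow> balanced c"
proof -
  \<comment> \<open>The empty graph satisfies both conditions, so the case distinction on empty parts disappears.\<close>
  have empty: "triangle_free (induced (halved_cube D) {})" "regular k (induced (halved_cube D) {})"
    for k
    by (auto simp: triangle_free_def regular_def halved_induced_simps)
  have "(\<forall>i\<in>{1..q}. defender_parts q D c i \<noteq> {} \<longrightarrow>
      triangle_free (induced (halved_cube D) (defender_parts q D c i)) \<and>
      regular (q - 2) (induced (halved_cube D) (defender_parts q D c i)))
    \<longleftrightarrow> (\<forall>i\<in>{1..q}. triangle_free (induced (halved_cube D) (colour_class c i \<inter> D)) \<and>
      regular (q - 2) (induced (halved_cube D) (colour_class c i \<inter> D)))"
    using empty by (intro ball_cong refl) (auto simp: defender_parts_def)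
  also have "\<dots> \<longleftrightarrow> (\<forall>x\<in>I. \<forall>i\<in>{1..q}. mult c x i \<le> 2) \<and>
      (\<forall>v\<in>D. card {w. c w = c v \<and> hamming_dist v w = 2} = q - 2)"
    unfolding triangle_free_colour_class_iff regular_colour_class_iff using assms by blast
  also have "\<dots> \<longleftrightarrow> balanced c"
  proof -
    have "card {w. c w = c v \<and> hamming_dist v w = 2} = q - 2 \<longleftrightarrow>
        card {x \<in> nbhd hypercube v. mult c x (c v) = 1} = 1"
      if "\<forall>x\<in>I. \<forall>i\<in>{1..q}. mult c x i \<le> 2" "v \<in> D" for v
    proof -
      have "mult c x (c v) \<le> 2" if "x \<in> nbhd hypercube v" for x
        using that \<open>v \<in> D\<close> nbhd_mem_I assms \<open>\<forall>x\<in>I. _ x\<close> by blast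
      from degree_identity[OF this] show ?thesis
        using q_ge_2 card_coords by auto
    qed
    then show ?thesis
      using assms unfolding balanced_def by auto
  qed
  finally show ?thesis .
qed

section \<open>Extremal colourings are the balanced ones, completed by the missing colours\<close>

text \<open>
  Defending single vertices makes every colour other than \<open>c x\<close> occur around \<open>x\<close>, so there is one zero
  and hence at least one colour of multiplicity one.  Defending pairs gives the opposite bound at the
  vertices of \<open>D\<close>: two neighbours of \<open>v\<close> around which \<open>v\<close> is alone in its colour would both
  need \<open>v\<close> as defender.
\<close>

lemma extremal_imp_balanced:
  assumes "extremal_pair_defensive I q c"
  shows "balanced c" and "x \<in> I \<Longrightarrow> mult c x (c x) = 0"
proof -
  have pd: "pair_defensive I q c"
    using assms unfolding extremal_pair_defensive_def by (rule conjunct1)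
  note pd = pd[unfolded pair_defensive_def]
  note range = pd[THEN conjunct1]
    and proper = pd[THEN conjunct2, THEN conjunct1]
  have defend: "\<exists>f. f ` S \<subseteq> colour_class c i \<and> inj_on f S \<and>
      (\<forall>x\<in>S. f x \<in> closed_nbhd hypercube x)"
    if "i \<in> {1..q}" "S \<subseteq> I" "card S \<le> 2" for i S
    using pd[THEN conjunct2, THEN conjunct2, rule_format, OF that(1)] that(2,3) by simp
  have D: "c ` D \<subseteq> {1..q}" using range by blast
  have proper': "c v \<noteq> c x" if "v \<in> nbhd hypercube x" for v x
  proof -
    have "c x \<noteq> c v"
      using proper that by (auto simp: proper_colouring_def nbhd_def hypercube_def)
    then show ?thesis by (rule not_sym)
  qed
  then show missing: "mult c x (c x) = 0" for x
    by (simp add: mult_eq_0_iff)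
  have present: "mult c x i \<noteq> 0" if "x \<in> I" "i \<in> {1..q}" "i \<noteq> c x" for x i
  proof -
    obtain f where "f ` {x} \<subseteq> colour_class c i" "\<forall>z\<in>{x}. f z \<in> closed_nbhd hypercube z"
      using defend[of i "{x}"] \<open>x \<in> I\<close> \<open>i \<in> {1..q}\<close> by auto
    then have "c (f x) = i" "f x \<in> closed_nbhd hypercube x"
      by (simp_all add: colour_class_def)
    with \<open>i \<noteq> c x\<close> show ?thesis
      by (auto simp: closed_nbhd_def mult_eq_0_iff)
  qed
  have id: "card {i \<in> {1..q}. mult c x i = 1} = 1 + (\<Sum>i\<in>{1..q}. mult c x i - 2)"
    if "x \<in> I" for x
  proof -
    have "c x \<in> {1..q}" using range by blast
    then have "i \<in> {i \<in> {1..q}. mult c x i = 0} \<longleftrightarrow> i \<in> {c x}" for i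
      using present[OF that, of i] missing[of x] by (cases "i = c x") auto
    then have "{i \<in> {1..q}. mult c x i = 0} = {c x}"
      by (rule set_eqI)
    then show ?thesis
      using zeros_ones_identity_mult[OF that D] by simp
  qed
  have le1: "card {x \<in> nbhd hypercube v. mult c x (c v) = 1} \<le> 1" if "v \<in> D" for v
  proof -
    have "x = y" if x: "x \<in> nbhd hypercube v" "mult c x (c v) = 1"
      and y: "y \<in> nbhd hypercube v" "mult c y (c v) = 1" for x y
    proof (rule ccontr)
      assume "x \<noteq> y"
      have "c v \<in> {1..q}" using range by blast
      moreover have "{x, y} \<subseteq> I" using x y nbhd_mem_I[OF \<open>v \<in> D\<close>] by blast
      moreover have "card {x, y} \<le> 2" by (simp add: card_insert_if)
      ultimately obtain f where f: "f ` {x, y} \<subseteq> colour_class c (c v)" "inj_on f {x, y}"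
          "\<forall>x\<in>{x, y}. f x \<in> closed_nbhd hypercube x"
        using defend by metis
      have "f z = v" if "z \<in> {x, y}" for z
      proof -
        have z: "z \<in> nbhd hypercube v" "mult c z (c v) = 1" using that x y by auto
        have "c (f z) = c v" "f z \<in> closed_nbhd hypercube z"
          using f that by (auto simp: colour_class_def)
        moreover from this have "f z \<noteq> z" using proper'[OF z(1)] by metis
        ultimately have "f z \<in> nbhd hypercube z" by (simp add: closed_nbhd_def)
        moreover have "v \<in> nbhd hypercube z" using z(1) nbhd_sym by blast
        ultimately show ?thesis
          using mult_eq_1_unique[OF z(2)] \<open>c (f z) = c v\<close> by blast
      qed
      then have "f x = f y" by simp
      with f(2) \<open>x \<noteq> y\<close> show False by (simp add: inj_on_def)
    qed
    then show ?thesis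
      by (auto simp: card_le_Suc0_iff_eq)
  qed
  have ge1: "1 \<le> card {i \<in> {1..q}. mult c x i = 1}" if "x \<in> I" for x
    using id[OF that] by simp
  have "card {i \<in> {1..q}. mult c x i = 1} = 1" if "x \<in> I" for x
    using one_colour_of_mult_1(1)[OF D] ge1 le1 that by blast
  with id have "mult c x i \<le> 2" if "x \<in> I" "i \<in> {1..q}" for x i
    using that by simp
  moreover have "card {x \<in> nbhd hypercube v. mult c x (c v) = 1} = 1" if "v \<in> D" for v
    using one_colour_of_mult_1(2)[OF D] ge1 le1 that by blast
  ultimately show "balanced c"
    using D by (simp add: balanced_def)
qed

text \<open>
  Every colour occurs in \<open>N[x]\<close>, as only \<open>c x\<close> is missing from \<open>N(x)\<close>.  By Hall's condition for two
  sets, a pair \<open>x, y\<close> could then be undefended in colour \<open>i\<close> only if both closed neighbourhoods meet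
  that colour in the same single vertex \<open>v\<close>.  If \<open>v \<in> I\<close>, then \<open>x = v = y\<close>; if \<open>v \<in> D\<close>, both \<open>x\<close>
  and \<open>y\<close> are neighbours of \<open>v\<close> where its colour has multiplicity one, and balance allows one.
\<close>

lemma balanced_imp_extremal:
  assumes bal: "balanced c"
    and missing: "\<And>x. x \<in> I \<Longrightarrow> c x \<in> {1..q} \<and> mult c x (c x) = 0"
  shows "extremal_pair_defensive I q c"
proof -
  have D: "c ` D \<subseteq> {1..q}" using bal by (simp add: balanced_def)
  have colour: "\<exists>u. c u = i \<and> u \<in> closed_nbhd hypercube x" if "x \<in> I" "i \<in> {1..q}" for x i
  proof (cases "c x = i")
    case True
    then show ?thesis by (auto simp: closed_nbhd_def)
  next
    case False
    then have "mult c x i \<noteq> 0"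
      using balanced_missing_colour[OF bal that(1)] missing[OF that(1)] that(2) by metis
    then show ?thesis by (auto simp: mult_eq_0_iff closed_nbhd_def)
  qed
  have "range c = {1..q}"
  proof
    have "c x \<in> {1..q}" for x
      by (cases "x \<in> I") (use D missing mem_I_iff in blast)+
    then show "range c \<subseteq> {1..q}" by blast
    obtain x where "x \<in> I" using I_nonempty by blast
    then show "{1..q} \<subseteq> range c" using colour by blast
  qed
  moreover have "proper_colouring hypercube c"
  proof -
    have *: "c v \<noteq> c x" if "x \<in> I" "v \<in> nbhd hypercube x" for x v
      using missing that by (auto simp: mult_eq_0_iff)
    have "c x \<noteq> c y" if "y \<in> nbhd hypercube x" for x y
    proof (cases "x \<in> I")
      case True
      with * that show ?thesis by metis
    next
      case False
      with that have "y \<in> I" "x \<in> nbhd hypercube y"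
        using nbhd_mem_I mem_I_iff nbhd_sym by blast+
      with * show ?thesis by metis
    qed
    then show ?thesis
      by (auto simp: proper_colouring_def nbhd_def)
  qed
  moreover have "\<exists>f. f ` S \<subseteq> colour_class c i \<and> inj_on f S \<and> (\<forall>x\<in>S. f x \<in> closed_nbhd hypercube x)"
    if i: "i \<in> {1..q}" and S: "S \<subseteq> I" "card S \<le> 2" for i S
  proof -
    \<comment> \<open>Any choice of defenders works unless two distinct vertices are to be defended.\<close>
    obtain g where g: "\<And>x. x \<in> I \<Longrightarrow> c (g x) = i \<and> g x \<in> closed_nbhd hypercube x"
      using colour[OF _ i] by metis
    show ?thesis
    proof (cases "card S = 2")
      case False
      then have "card S \<le> Suc 0" using S(2) by simp
      then have "inj_on g S"
        by (auto simp: inj_on_def card_le_Suc0_iff_eq)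
      with g S(1) show ?thesis
        by (intro exI[of _ g]) (auto simp: colour_class_def)
    next
      case True
      then obtain x y where xy: "S = {x, y}" "x \<noteq> y" unfolding card_2_iff by blast
      with S(1) have I: "x \<in> I" "y \<in> I" by auto
      have "\<exists>u w. c u = i \<and> u \<in> closed_nbhd hypercube x \<and>
          c w = i \<and> w \<in> closed_nbhd hypercube y \<and> u \<noteq> w"
      proof (rule ccontr)
        assume "\<not> ?thesis"
        then have eq: "u = w" if "c u = i" "u \<in> closed_nbhd hypercube x"
            "c w = i" "w \<in> closed_nbhd hypercube y" for u w
          using that by metis
        define v where "v = g x"
        have "v = g y"
          using eq g I unfolding v_def by simp
        have v: "c v = i" "v \<in> closed_nbhd hypercube x" "v \<in> closed_nbhd hypercube y"
          using g[OF I(1)] g[OF I(2)] \<open>v = g y\<close> by (simp_all add: v_def)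
        have only: "u = v" if "c u = i" "z = x \<or> z = y" "u \<in> closed_nbhd hypercube z" for u z
          using that eq[of u v] eq[of v u] v by auto
        show False
        proof (cases "v \<in> I")
          case True
          have "v = z" if "z \<in> I" "v \<in> closed_nbhd hypercube z" for z
            using that True nbhd_mem_D mem_I_iff unfolding closed_nbhd_def by blast
          with v I xy(2) show False by metis
        next
          case False
          then have "v \<in> D" using mem_I_iff by blast
          have "z \<in> {z \<in> nbhd hypercube v. mult c z (c v) = 1}" if z: "z = x \<or> z = y" for z
          proof -
            have vz: "v \<in> nbhd hypercube z"
              using z v(2,3) I False by (auto simp: closed_nbhd_def)
            have "{u \<in> nbhd hypercube z. c u = i} = {v}"
            proof
              show "{u \<in> nbhd hypercube z. c u = i} \<subseteq> {v}"
              proof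
                fix u assume "u \<in> {u \<in> nbhd hypercube z. c u = i}"
                then have "c u = i" "u \<in> closed_nbhd hypercube z"
                  by (simp_all add: closed_nbhd_def)
                then have "u = v" by (intro only[OF _ z])
                then show "u \<in> {v}" by simp
              qed
              show "{v} \<subseteq> {u \<in> nbhd hypercube z. c u = i}"
                using vz v(1) by simp
            qed
            moreover have "z \<in> nbhd hypercube v"
              using vz nbhd_sym by blast
            ultimately show ?thesis
              using v(1) by (simp add: mult_def)
          qed
          moreover have "card {z \<in> nbhd hypercube v. mult c z (c v) = 1} = 1"
            using bal \<open>v \<in> D\<close> by (simp add: balanced_def)
          ultimately show False
            using xy(2) by (metis (no_types, lifting) card_1_singletonE singletonD)
        qed
      qed
      then obtain u w where "c u = i" "u \<in> closed_nbhd hypercube x"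
          "c w = i" "w \<in> closed_nbhd hypercube y" "u \<noteq> w" by blast
      with xy show ?thesis
        by (intro exI[of _ "\<lambda>z. if z = x then u else w"]) (auto simp: colour_class_def)
    qed
  qed
  moreover have "q = (CARD('n) + 3) div 2"
    using q_ge_2 card_coords by simp
  ultimately show ?thesis
    unfolding extremal_pair_defensive_def pair_defensive_def by simp
qed

section \<open>The correspondence\<close>

text \<open>
  The parts determine the colouring on \<open>D\<close>, hence all multiplicities at \<open>x \<in> I\<close>; the colour of \<open>x\<close> is the
  one whose multiplicity is zero.
\<close>

lemma inj_on_defender_parts: "inj_on (defender_parts q D) {c. extremal_pair_defensive I q c}"
proof (rule inj_onI, rule ext)
  fix c c' x
  assume "c \<in> {c. extremal_pair_defensive I q c}" "c' \<in> {c. extremal_pair_defensive I q c}"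
  then have c: "balanced c" "x \<in> I \<Longrightarrow> mult c x (c x) = 0" "range c = {1..q}"
    and c': "balanced c'" "x \<in> I \<Longrightarrow> mult c' x (c' x) = 0" "range c' = {1..q}" for x
    using extremal_imp_balanced by (auto simp: extremal_pair_defensive_def pair_defensive_def)
  assume eq: "defender_parts q D c = defender_parts q D c'"
  have D: "c v = c' v" if "v \<in> D" for v
  proof -
    have "c v \<in> {1..q}" using c(3) by blast
    then have "v \<in> defender_parts q D c (c v)"
      using that by (simp add: defender_parts_def colour_class_def)
    then show ?thesis
      unfolding eq using \<open>c v \<in> {1..q}\<close> by (simp add: defender_parts_def colour_class_def)
  qed
  show "c x = c' x"
  proof (cases "x \<in> I")
    case True
    then have "mult c x i = mult c' x i" for i
      using D nbhd_mem_D by (intro mult_cong) blast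
    then have "mult c' x (c x) = 0"
      using c(2)[OF True] by simp
    moreover have "c x \<in> {1..q}" "c' x \<in> {1..q}"
      using c(3) c'(3) by blast+
    ultimately show ?thesis
      using balanced_missing_colour[OF c'(1) True] c'(2)[OF True] by blast
  next
    case False
    with D show ?thesis by (simp add: mem_I_iff)
  qed
qed

lemma defender_parts_in_near_partitions:
  assumes "c ` D \<subseteq> {1..q}"
  shows "defender_parts q D c \<in> near_partitions q D"
  using assms
  by (auto simp: near_partitions_def defender_parts_def colour_class_def disjoint_family_on_def)

lemma near_partition_is_defender_parts:
  assumes "B \<in> near_partitions q D"
  obtains c where "c ` D \<subseteq> {1..q}" "B = defender_parts q D c"
proof -
  have ext: "B \<in> extensional {1..q}" and disj: "disjoint_family_on B {1..q}"
    and Un: "(\<Union>i\<in>{1..q}. B i) = D"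
    using assms by (auto simp: near_partitions_def)
  have "\<forall>v\<in>D. \<exists>i\<in>{1..q}. v \<in> B i" using Un by blast
  then obtain c where c: "\<And>v. v \<in> D \<Longrightarrow> c v \<in> {1..q} \<and> v \<in> B (c v)" by metis
  have "B i = colour_class c i \<inter> D" if "i \<in> {1..q}" for i
  proof
    show "B i \<subseteq> colour_class c i \<inter> D"
    proof
      fix v assume "v \<in> B i"
      with that Un have "v \<in> D" by blast
      with c disj that \<open>v \<in> B i\<close> have "c v = i"
        unfolding disjoint_family_on_def by blast
      with \<open>v \<in> D\<close> show "v \<in> colour_class c i \<inter> D"
        by (simp add: colour_class_def)
    qed
    show "colour_class c i \<inter> D \<subseteq> B i"
      using c by (auto simp: colour_class_def)
  qed
  then have "B = defender_parts q D c"
    using ext by (intro extensionalityI[of _ "{1..q}"]) (auto simp: defender_parts_def)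
  with c show thesis by (intro that) auto
qed

lemma balanced_completion:
  assumes "balanced f"
  obtains c where "\<And>v. v \<in> D \<Longrightarrow> c v = f v" "extremal_pair_defensive I q c"
proof -
  obtain h where h: "\<And>x. x \<in> I \<Longrightarrow> h x \<in> {1..q} \<and> mult f x (h x) = 0"
    using balanced_missing_colour[OF assms] by metis
  define c where "c v = (if v \<in> D then f v else h v)" for v
  have cD: "c v = f v" if "v \<in> D" for v
    using that by (simp add: c_def)
  have "extremal_pair_defensive I q c"
  proof (rule balanced_imp_extremal)
    show "balanced c" using balanced_cong[OF _ assms] cD by metis
    fix x assume "x \<in> I"
    then have "c x = h x" by (simp add: c_def mem_I_iff)
    moreover have "mult c x i = mult f x i" for i
      using \<open>x \<in> I\<close> cD nbhd_mem_D by (intro mult_cong) blast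
    ultimately show "c x \<in> {1..q} \<and> mult c x (c x) = 0"
      using h[OF \<open>x \<in> I\<close>] by simp
  qed
  with cD show thesis by (rule that)
qed

lemma nbhd_avoids_part_iff:
  assumes "x \<in> I" "i \<in> {1..q}"
  shows "nbhd hypercube x \<inter> defender_parts q D c i = {} \<longleftrightarrow> mult c x i = 0"
  using assms nbhd_mem_D[OF assms(1)]
  by (auto simp: mult_eq_0_iff defender_parts_def colour_class_def)

end

theorem theorem4p2:
  fixes q :: nat and I D :: "(bit ^ 'n::finite) set"
  assumes "q \<ge> 2"
    and "CARD('n) = 2 * q - 3"
    and "(I = even_class \<and> D = odd_class) \<or> (I = odd_class \<and> D = even_class)"
  shows "bij_betw (defender_parts q D)
           {c. extremal_pair_defensive I q c}
           {B \<in> near_partitions q D. \<forall>i\<in>{1..q}. B i \<noteq> {} \<longrightarrow>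
              triangle_free (induced (halved_cube D) (B i)) \<and>
              regular (q - 2) (induced (halved_cube D) (B i))} \<and>
         (\<forall>c. extremal_pair_defensive I q c \<longrightarrow>
           (\<forall>x\<in>I. (\<exists>!i. i \<in> {1..q} \<and> nbhd hypercube x \<inter> defender_parts q D c i = {}) \<and>
                  nbhd hypercube x \<inter> defender_parts q D c (c x) = {}))"
    (is "bij_betw _ ?Ext ?Good \<and> ?Unique")
proof -
  interpret parity_classes q I D
    using assms by unfold_locales
  have balancedD: "c ` D \<subseteq> {1..q}" if "balanced c" for c
    using that by (simp add: balanced_def)
  have "defender_parts q D ` ?Ext = ?Good"
  proof
    show "defender_parts q D ` ?Ext \<subseteq> ?Good"
    proof
      fix B assume "B \<in> defender_parts q D ` ?Ext"
      then obtain c where "balanced c" "B = defender_parts q D c"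
        using extremal_imp_balanced(1) by blast
      then show "B \<in> ?Good"
        using balancedD[of c] defender_parts_in_near_partitions[of c] good_parts_iff_balanced[of c]
        by simp
    qed
    show "?Good \<subseteq> defender_parts q D ` ?Ext"
    proof
      fix B assume B: "B \<in> ?Good"
      then obtain f where f: "f ` D \<subseteq> {1..q}" "B = defender_parts q D f"
        using near_partition_is_defender_parts by blast
      with B have "balanced f"
        using good_parts_iff_balanced[of f] by simp
      then obtain c where c: "\<And>v. v \<in> D \<Longrightarrow> c v = f v" "extremal_pair_defensive I q c"
        using balanced_completion by blast
      have "defender_parts q D c = B"
      proof -
        have "colour_class c i \<inter> D = colour_class f i \<inter> D" for i
          using c(1) by (auto simp: colour_class_def)
        then show ?thesis
          unfolding f(2) by (simp add: defender_parts_def)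
      qed
      with c(2) show "B \<in> defender_parts q D ` ?Ext" by blast
    qed
  qed
  then have "bij_betw (defender_parts q D) ?Ext ?Good"
    using inj_on_defender_parts by (simp add: bij_betw_def)
  moreover have ?Unique
  proof (intro allI impI ballI)
    fix c x assume c: "extremal_pair_defensive I q c" and "x \<in> I"
    have "c x \<in> {1..q}"
      using c by (auto simp: extremal_pair_defensive_def pair_defensive_def)
    then have "nbhd hypercube x \<inter> defender_parts q D c (c x) = {}"
      using nbhd_avoids_part_iff[OF \<open>x \<in> I\<close>] extremal_imp_balanced(2)[OF c \<open>x \<in> I\<close>] by blast
    moreover have "\<exists>!i. i \<in> {1..q} \<and> nbhd hypercube x \<inter> defender_parts q D c i = {}"
      using balanced_missing_colour[OF extremal_imp_balanced(1)[OF c] \<open>x \<in> I\<close>]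
        nbhd_avoids_part_iff[OF \<open>x \<in> I\<close>] by (simp cong: conj_cong)
    ultimately show "(\<exists>!i. i \<in> {1..q} \<and> nbhd hypercube x \<inter> defender_parts q D c i = {}) \<and>
        nbhd hypercube x \<inter> defender_parts q D c (c x) = {}"
      by blast
  qed
  ultimately show ?thesis by blast
qed

end
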